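(* For every $\alpha\in Fm''$: if $\models_{\cal TML}\alpha$, then $\vdash_{\mathbb T}\alpha$.
   Context: $M_4=\{\mathbf 0,\mathbf n,\mathbf b,\mathbf 1\}$ with $\neg\mathbf 0=\mathbf 1$, $\neg\mathbf 1=\mathbf 0$, $\neg\mathbf n=\mathbf n$, $\neg\mathbf b=\mathbf b$ and $\succ$: $\mathbf 0\succ y=\mathbf 1$; $\mathbf n\succ\mathbf 0=\mathbf n$, $\mathbf n\succ\mathbf n=\mathbf 1$, $\mathbf n\succ\mathbf b=\mathbf b$, $\mathbf n\succ\mathbf 1=\mathbf 1$; $\mathbf b\succ\mathbf 0=\mathbf b$, $\mathbf b\succ\mathbf n=\mathbf n$, $\mathbf b\succ\mathbf b=\mathbf 1$, $\mathbf b\succ\mathbf 1=\mathbf 1$; $\mathbf 1\succ y=y$. Formulas of $Fm''$ are built from propositional variables with $\neg$, $\succ$; a valuation is a homomorphism $h:Fm''\to M_4$; $\models_{\cal TML}\alpha$ means $h(\alpha)=\mathbf 1$ for every valuation $h$. Signed formulas are $T(\alpha)$, $F(\alpha)$. Rules of $\mathbb T$ (premise $\Rightarrow$ conclusion sets separated by $|$): $T(\alpha\succ\beta)\Rightarrow \{T(\beta)\}\,|\,\{T(\neg\alpha),F(\beta),T(\neg\beta)\}\,|\,\{F(\alpha),F(\beta),F(\neg\beta)\}$; $F(\alpha\succ\beta)\Rightarrow\{T(\alpha),F(\beta),F(\neg\beta)\}\,|\,\{F(\neg\alpha),F(\beta),T(\neg\beta)\}$; $T(\neg(\alpha\succ\beta))\Rightarrow\{T(\alpha),F(\beta),T(\neg\beta)\}\,|\,\{F(\neg\alpha),T(\beta),T(\neg\beta)\}$;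 $F(\neg(\alpha\succ\beta))\Rightarrow\{F(\neg\beta)\}\,|\,\{T(\neg\alpha),T(\beta),T(\neg\beta)\}\,|\,\{F(\alpha),F(\beta),T(\neg\beta)\}$; $T(\neg\neg\alpha)\Rightarrow\{T(\alpha)\}$; $F(\neg\neg\alpha)\Rightarrow\{F(\alpha)\}$. A tableau for $\eta$ is a finite tree with root $\eta$ built by repeatedly choosing a non-closed branch and a signed formula on it that is a rule premise, and extending the branch by one sub-branch per conclusion set. A branch is closed if it contains $T(\gamma)$ and $F(\gamma)$ for some $\gamma$; a tableau is closed if all branches are closed. $\vdash_{\mathbb T}\alpha$ means there exists a closed tableau for $F(\alpha)$. *)

theory Defs
  imports Main
begin

datatype m4 = Zero4 | N4 | B4 | One4

fun neg4 :: "m4 \<Rightarrow> m4" where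
  "neg4 Zero4 = One4"
| "neg4 One4 = Zero4"
| "neg4 N4 = N4"
| "neg4 B4 = B4"

fun imp4 :: "m4 \<Rightarrow> m4 \<Rightarrow> m4" where
  "imp4 Zero4 y = One4"
| "imp4 N4 Zero4 = N4"
| "imp4 N4 N4 = One4"
| "imp4 N4 B4 = B4"
| "imp4 N4 One4 = One4"
| "imp4 B4 Zero4 = B4"
| "imp4 B4 N4 = N4"
| "imp4 B4 B4 = One4"
| "imp4 B4 One4 = One4"
| "imp4 One4 y = y"

text \<open>The set of propositional variables is the arbitrary type \<open>'v\<close>.\<close>

datatype 'v fm =
    Var 'v
  | Neg "'v fm"  (\<open>\<sim> _\<close> [80] 80)
  | Imp "'v fm" "'v fm"  (infixr \<open>\<succ>\<close> 70)

definition valuation :: "('v fm \<Rightarrow> m4) \<Rightarrow> bool" where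
  "valuation h \<longleftrightarrow>
     (\<forall>\<alpha>. h (\<sim> \<alpha>) = neg4 (h \<alpha>)) \<and> (\<forall>\<alpha> \<beta>. h (\<alpha> \<succ> \<beta>) = imp4 (h \<alpha>) (h \<beta>))"

definition tml_valid :: "'v fm \<Rightarrow> bool"  (\<open>\<Turnstile>\<^sub>T\<^sub>M\<^sub>L _\<close> [50] 50) where
  "\<Turnstile>\<^sub>T\<^sub>M\<^sub>L \<alpha> \<longleftrightarrow> (\<forall>h. valuation h \<longrightarrow> h \<alpha> = One4)"

datatype 'v sfm = T "'v fm" | F "'v fm"

text \<open>\<open>tableau_rule \<sigma> Cs\<close>: a rule has premise \<open>\<sigma>\<close> and the conclusion sets listed in \<open>Cs\<close>.\<close>

inductive tableau_rule :: "'v sfm \<Rightarrow> 'v sfm set list \<Rightarrow> bool" where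
  T_Imp: "tableau_rule (T (\<alpha> \<succ> \<beta>))
    [{T \<beta>}, {T (\<sim> \<alpha>), F \<beta>, T (\<sim> \<beta>)}, {F \<alpha>, F \<beta>, F (\<sim> \<beta>)}]"
| F_Imp: "tableau_rule (F (\<alpha> \<succ> \<beta>))
    [{T \<alpha>, F \<beta>, F (\<sim> \<beta>)}, {F (\<sim> \<alpha>), F \<beta>, T (\<sim> \<beta>)}]"
| T_Neg_Imp: "tableau_rule (T (\<sim> (\<alpha> \<succ> \<beta>)))
    [{T \<alpha>, F \<beta>, T (\<sim> \<beta>)}, {F (\<sim> \<alpha>), T \<beta>, T (\<sim> \<beta>)}]"
| F_Neg_Imp: "tableau_rule (F (\<sim> (\<alpha> \<succ> \<beta>)))
    [{F (\<sim> \<beta>)}, {T (\<sim> \<alpha>), T \<beta>, T (\<sim> \<beta>)}, {F \<alpha>, F \<beta>, T (\<sim> \<beta>)}]"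
| T_Neg_Neg: "tableau_rule (T (\<sim> \<sim> \<alpha>)) [{T \<alpha>}]"
| F_Neg_Neg: "tableau_rule (F (\<sim> \<sim> \<alpha>)) [{F \<alpha>}]"

datatype 'a tree = Node 'a "'a tree list"

fun branches :: "'a tree \<Rightarrow> 'a list set" where
  "branches (Node x ts) =
     (if ts = [] then {[x]} else (\<Union>t \<in> set ts. (\<lambda>b. x # b) ` branches t))"

definition closed_branch :: "'v sfm list \<Rightarrow> bool" where
  "closed_branch b \<longleftrightarrow> (\<exists>\<gamma>. T \<gamma> \<in> set b \<and> F \<gamma> \<in> set b)"

text \<open>\<open>sub_branch C t\<close>: \<open>t\<close> is a non-branching tree whose nodes enumerate the
  finite set \<open>C\<close> without repetition, in some order.\<close>

inductive sub_branch :: "'a set \<Rightarrow> 'a tree \<Rightarrow> bool" where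
  single: "sub_branch {x} (Node x [])"
| step: "x \<notin> C \<Longrightarrow> sub_branch C t \<Longrightarrow> sub_branch (insert x C) (Node x [t])"

text \<open>\<open>extends b t t'\<close>: the tree \<open>t'\<close> arises from \<open>t\<close> by one rule application at the end of
  one branch of \<open>t\<close>. Here \<open>t\<close> is viewed as a subtree of a larger tree, and \<open>b\<close> lists
  the signed formulas on the path from the root of the larger tree down to, but excluding,
  the root of \<open>t\<close>.\<close>

inductive extends :: "'v sfm list \<Rightarrow> 'v sfm tree \<Rightarrow> 'v sfm tree \<Rightarrow> bool" where
  leaf: "\<not> closed_branch (b @ [x]) \<Longrightarrow> \<sigma> \<in> set (b @ [x]) \<Longrightarrow> tableau_rule \<sigma> Cs \<Longrightarrow>
    list_all2 sub_branch Cs ts \<Longrightarrow> extends b (Node x []) (Node x ts)"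
| inner: "extends (b @ [x]) t t' \<Longrightarrow>
    extends b (Node x (us @ t # vs)) (Node x (us @ t' # vs))"

inductive tableau :: "'v sfm \<Rightarrow> 'v sfm tree \<Rightarrow> bool" for \<eta> where
  root: "tableau \<eta> (Node \<eta> [])"
| extend: "tableau \<eta> t \<Longrightarrow> extends [] t t' \<Longrightarrow> tableau \<eta> t'"

definition closed_tableau :: "'v sfm tree \<Rightarrow> bool" where
  "closed_tableau t \<longleftrightarrow> (\<forall>b \<in> branches t. closed_branch b)"

definition tableau_provable :: "'v fm \<Rightarrow> bool"  (\<open>\<turnstile>\<^sub>T _\<close> [50] 50) where
  "\<turnstile>\<^sub>T \<alpha> \<longleftrightarrow> (\<exists>t. tableau (F \<alpha>) t \<and> closed_tableau t)"

end

theory Submission imports Defs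
begin

text \<open>
  Read \<open>T \<phi>\<close> as ``the value of \<open>\<phi>\<close> is \<open>\<^bold>b\<close> or \<open>\<^bold>1\<close>'' and \<open>F \<phi>\<close> as its negation. Under this
  reading every conclusion set of a rule entails its premise, so a set of signed formulas that
  is free of clashes and saturated under the rules has a model. If \<open>F \<alpha>\<close> has no model, then every
  non-closed branch starting from \<open>F \<alpha>\<close> admits a rule application that adds a new
  formula to each of its extensions. All formulas on such branches are signed subformulas of \<open>\<alpha>\<close>
  or negations of them, so only finitely many rule applications are possible and the tableau closes.
\<close>

section \<open>Hintikka sets and their models\<close>

definition designated :: "m4 \<Rightarrow> bool" where
  "designated a \<longleftrightarrow> a = B4 \<or> a = One4"

definition hintikka :: "'v sfm set \<Rightarrow> bool" where
  "hintikka H \<longleftrightarrow> (\<forall>\<gamma>. \<not> (T \<gamma> \<in> H \<and> F \<gamma> \<in> H)) \<and>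
     (\<forall>\<sigma> \<in> H. \<forall>Cs. tableau_rule \<sigma> Cs \<longrightarrow> (\<exists>C \<in> set Cs. C \<subseteq> H))"

primrec eval4 :: "('v \<Rightarrow> m4) \<Rightarrow> 'v fm \<Rightarrow> m4" where
  "eval4 v (Var p) = v p"
| "eval4 v (\<sim> \<phi>) = neg4 (eval4 v \<phi>)"
| "eval4 v (\<phi> \<succ> \<psi>) = imp4 (eval4 v \<phi>) (eval4 v \<psi>)"

lemma valuation_eval4: "valuation (eval4 v)"
  by (simp add: valuation_def)

text \<open>A value of \<open>m4\<close> is determined by whether it and its negation are
  designated: \<open>One4\<close> is (yes, no), \<open>B4\<close> (yes, yes), \<open>N4\<close> (no,
  no), \<open>Zero4\<close> (no, yes). A missing \<open>T\<close> entry counts as "no", which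
  respects the \<open>F\<close> entries of a set without clashes.\<close>

definition hintikka_val :: "'v sfm set \<Rightarrow> 'v \<Rightarrow> m4" where
  "hintikka_val H p =
     (if T (Var p) \<in> H then (if T (\<sim> Var p) \<in> H then B4 else One4)
      else (if T (\<sim> Var p) \<in> H then Zero4 else N4))"

lemma hintikka_ruleD:
  assumes "hintikka H" "\<sigma> \<in> H" "tableau_rule \<sigma> Cs"
  shows "\<exists>C \<in> set Cs. C \<subseteq> H"
  using assms unfolding hintikka_def by blast

text \<open>The rule conclusions for an implication mention its components and also their negations.
  A negation of a component is not a structurally smaller formula, so the induction carries the
  claims for \<phi> and for its negation together.\<close>

lemma hintikka_model:
  assumes H: "hintikka H"
  defines "h \<equiv> eval4 (hintikka_val H)"
  shows "(T \<phi> \<in> H \<longrightarrow> designated (h \<phi>)) \<and> (F \<phi> \<in> H \<longrightarrow> \<not> designated (h \<phi>)) \<and>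
    (T (\<sim> \<phi>) \<in> H \<longrightarrow> designated (neg4 (h \<phi>))) \<and> (F (\<sim> \<phi>) \<in> H \<longrightarrow> \<not> designated (neg4 (h \<phi>)))"
proof (induction \<phi>)
  case (Var p)
  have "\<not> (T \<gamma> \<in> H \<and> F \<gamma> \<in> H)" for \<gamma>
    using H by (simp add: hintikka_def)
  from this[of "Var p"] this[of "\<sim> Var p"] show ?case
    by (auto simp: h_def hintikka_val_def designated_def)
next
  case (Neg \<phi>)
  have "T (\<sim> \<sim> \<phi>) \<in> H \<Longrightarrow> T \<phi> \<in> H" "F (\<sim> \<sim> \<phi>) \<in> H \<Longrightarrow> F \<phi> \<in> H"
    using hintikka_ruleD[OF H _ T_Neg_Neg] hintikka_ruleD[OF H _ F_Neg_Neg] by auto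
  moreover have "neg4 (neg4 a) = a" for a
    by (cases a) auto
  ultimately show ?case
    using Neg by (simp add: h_def)
next
  case (Imp \<phi> \<psi>)
  have h: "h (\<phi> \<succ> \<psi>) = imp4 (h \<phi>) (h \<psi>)"
    by (simp add: h_def)
  \<comment> \<open>In each of the four cases some conclusion set lies in \<open>H\<close>. The
    induction hypotheses turn it into constraints on \<open>h \<phi>\<close> and
    \<open>h \<psi>\<close>, and the truth tables settle the sixteen pairs of values.\<close>
  have "designated (h (\<phi> \<succ> \<psi>))" if "T (\<phi> \<succ> \<psi>) \<in> H"
    using hintikka_ruleD[OF H that T_Imp] Imp unfolding h
    by (cases "h \<phi>"; cases "h \<psi>") (auto simp: designated_def)
  moreover have "\<not> designated (h (\<phi> \<succ> \<psi>))" if "F (\<phi> \<succ> \<psi>) \<in> H"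
    using hintikka_ruleD[OF H that F_Imp] Imp unfolding h
    by (cases "h \<phi>"; cases "h \<psi>") (auto simp: designated_def)
  moreover have "designated (neg4 (h (\<phi> \<succ> \<psi>)))" if "T (\<sim> (\<phi> \<succ> \<psi>)) \<in> H"
    using hintikka_ruleD[OF H that T_Neg_Imp] Imp unfolding h
    by (cases "h \<phi>"; cases "h \<psi>") (auto simp: designated_def)
  moreover have "\<not> designated (neg4 (h (\<phi> \<succ> \<psi>)))" if "F (\<sim> (\<phi> \<succ> \<psi>)) \<in> H"
    using hintikka_ruleD[OF H that F_Neg_Imp] Imp unfolding h
    by (cases "h \<phi>"; cases "h \<psi>") (auto simp: designated_def)
  ultimately show ?case by blast
qed

corollary valid_not_in_hintikka:
  assumes "\<Turnstile>\<^sub>T\<^sub>M\<^sub>L \<alpha>" "hintikka H"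
  shows "F \<alpha> \<notin> H"
proof
  assume "F \<alpha> \<in> H"
  then have "\<not> designated (eval4 (hintikka_val H) \<alpha>)"
    using hintikka_model[OF assms(2)] by blast
  then show False
    using assms(1) valuation_eval4 unfolding tml_valid_def designated_def by blast
qed

section \<open>A finite set of signed formulas closed under the rules\<close>

primrec subformulas :: "'v fm \<Rightarrow> 'v fm set" where
  "subformulas (Var p) = {Var p}"
| "subformulas (\<sim> \<phi>) = insert (\<sim> \<phi>) (subformulas \<phi>)"
| "subformulas (\<phi> \<succ> \<psi>) = insert (\<phi> \<succ> \<psi>) (subformulas \<phi> \<union> subformulas \<psi>)"

lemma finite_subformulas: "finite (subformulas \<phi>)"
  by (induction \<phi>) auto

lemma subformulas_refl: "\<phi> \<in> subformulas \<phi>"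
  by (cases \<phi>) auto

lemma subformulas_NegD: "\<sim> \<psi> \<in> subformulas \<phi> \<Longrightarrow> \<psi> \<in> subformulas \<phi>"
  by (induction \<phi>) (auto simp: subformulas_refl)

lemma subformulas_ImpD:
  "\<psi> \<succ> \<chi> \<in> subformulas \<phi> \<Longrightarrow> \<psi> \<in> subformulas \<phi> \<and> \<chi> \<in> subformulas \<phi>"
  by (induction \<phi>) (auto simp: subformulas_refl)

text \<open>One extra negation suffices: the rules put at most one negation in front of a component
  of an implication, and they strip double negations, so negations do not pile up.\<close>

definition signed_closure :: "'v fm \<Rightarrow> 'v sfm set" where
  "signed_closure \<alpha> = (let S = subformulas \<alpha> \<union> Neg ` subformulas \<alpha> in T ` S \<union> F ` S)"

lemma finite_signed_closure: "finite (signed_closure \<alpha>)"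
  by (simp add: signed_closure_def Let_def finite_subformulas)

lemma signed_closureI:
  assumes "\<phi> \<in> subformulas \<alpha>"
  shows "T \<phi> \<in> signed_closure \<alpha>" "F \<phi> \<in> signed_closure \<alpha>"
    "T (\<sim> \<phi>) \<in> signed_closure \<alpha>" "F (\<sim> \<phi>) \<in> signed_closure \<alpha>"
  using assms by (simp_all add: signed_closure_def Let_def image_iff)

lemma signed_closure_subformulas:
  assumes "T \<phi> \<in> signed_closure \<alpha> \<or> F \<phi> \<in> signed_closure \<alpha>"
  shows "\<phi> \<in> subformulas \<alpha> \<or> (\<exists>\<psi>. \<phi> = \<sim> \<psi> \<and> \<psi> \<in> subformulas \<alpha>)"
  using assms unfolding signed_closure_def Let_def by blast

lemma signed_closure_ImpD:
  assumes "T (\<phi> \<succ> \<psi>) \<in> signed_closure \<alpha> \<or> F (\<phi> \<succ> \<psi>) \<in> signed_closure \<alpha>"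
  shows "\<phi> \<in> subformulas \<alpha> \<and> \<psi> \<in> subformulas \<alpha>"
  using signed_closure_subformulas[OF assms] subformulas_ImpD by blast

lemma signed_closure_NegD:
  assumes "T (\<sim> \<phi>) \<in> signed_closure \<alpha> \<or> F (\<sim> \<phi>) \<in> signed_closure \<alpha>"
  shows "\<phi> \<in> subformulas \<alpha>"
  using signed_closure_subformulas[OF assms] subformulas_NegD by blast

lemma tableau_rule_signed_closure:
  assumes "tableau_rule \<sigma> Cs" "\<sigma> \<in> signed_closure \<alpha>" "C \<in> set Cs"
  shows "C \<subseteq> signed_closure \<alpha>"
  using assms
proof (cases rule: tableau_rule.cases)
  case (T_Imp \<phi> \<psi>)
  then show ?thesis
    using assms(2,3) signed_closure_ImpD[of \<phi> \<psi> \<alpha>] by (auto intro: signed_closureI)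
next
  case (F_Imp \<phi> \<psi>)
  then show ?thesis
    using assms(2,3) signed_closure_ImpD[of \<phi> \<psi> \<alpha>] by (auto intro: signed_closureI)
next
  case (T_Neg_Imp \<phi> \<psi>)
  then have "\<phi> \<in> subformulas \<alpha> \<and> \<psi> \<in> subformulas \<alpha>"
    using assms(2) signed_closure_NegD subformulas_ImpD by blast
  then show ?thesis
    using T_Neg_Imp assms(3) by (auto intro: signed_closureI)
next
  case (F_Neg_Imp \<phi> \<psi>)
  then have "\<phi> \<in> subformulas \<alpha> \<and> \<psi> \<in> subformulas \<alpha>"
    using assms(2) signed_closure_NegD subformulas_ImpD by blast
  then show ?thesis
    using F_Neg_Imp assms(3) by (auto intro: signed_closureI)
next
  case (T_Neg_Neg \<phi>)
  then have "\<phi> \<in> subformulas \<alpha>"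
    using assms(2) signed_closure_NegD subformulas_NegD by blast
  then show ?thesis
    using T_Neg_Neg assms(3) by (auto intro: signed_closureI)
next
  case (F_Neg_Neg \<phi>)
  then have "\<phi> \<in> subformulas \<alpha>"
    using assms(2) signed_closure_NegD subformulas_NegD by blast
  then show ?thesis
    using F_Neg_Neg assms(3) by (auto intro: signed_closureI)
qed

section \<open>Closing trees by rule applications\<close>

lemma tableau_rule_finite_nonempty:
  assumes "tableau_rule \<sigma> Cs" "C \<in> set Cs"
  shows "finite C" "C \<noteq> {}"
  using assms by (cases rule: tableau_rule.cases; auto)+

lemma tableau_rule_not_Nil: "tableau_rule \<sigma> Cs \<Longrightarrow> Cs \<noteq> []"
  by (cases rule: tableau_rule.cases) auto

lemma sub_branch_exists:
  assumes "finite C" "C \<noteq> {}"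
  shows "\<exists>t. sub_branch C t"
  using assms by (induction rule: finite_ne_induct) (blast intro: sub_branch.intros)+

lemma tableau_rule_sub_branches:
  assumes "tableau_rule \<sigma> Cs"
  shows "\<exists>ts. list_all2 sub_branch Cs ts"
proof -
  have "\<forall>C \<in> set Cs. \<exists>t. sub_branch C t"
    using assms by (auto intro: sub_branch_exists dest: tableau_rule_finite_nonempty)
  then have "\<forall>C \<in> set Cs. sub_branch C (SOME t. sub_branch C t)"
    by (auto intro: someI_ex)
  then have "list_all2 sub_branch Cs (map (\<lambda>C. SOME t. sub_branch C t) Cs)"
    by (simp add: list_all2_map2 list.rel_refl_strong)
  then show ?thesis ..
qed

text \<open>As in \<open>extends\<close>, \<open>b\<close> is the path above the root of
  \<open>t\<close>. Keeping it as a parameter lets each subtree be closed on its own, although its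
  closure may use formulas higher up.\<close>

definition closable :: "'v sfm list \<Rightarrow> 'v sfm tree \<Rightarrow> bool" where
  "closable b t \<longleftrightarrow>
     (\<exists>t'. (extends b)\<^sup>*\<^sup>* t t' \<and> (\<forall>c \<in> branches t'. closed_branch (b @ c)))"

lemma extends_child_rtranclp:
  assumes "(extends (b @ [x]))\<^sup>*\<^sup>* t t'"
  shows "(extends b)\<^sup>*\<^sup>* (Node x (us @ t # vs)) (Node x (us @ t' # vs))"
  using assms
  by (induction rule: rtranclp_induct) (auto intro: rtranclp.rtrancl_into_rtrancl extends.inner)

text \<open>The children are processed from left to right; \<open>us\<close> collects those already
  finished and therefore varies in the induction.\<close>

lemma extends_children_rtranclp:
  assumes "list_all2 (extends (b @ [x]))\<^sup>*\<^sup>* ts ts'"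
  shows "(extends b)\<^sup>*\<^sup>* (Node x (us @ ts)) (Node x (us @ ts'))"
  using assms
proof (induction arbitrary: us rule: list_all2_induct)
  case Nil
  then show ?case by simp
next
  case (Cons t ts t' ts')
  have "(extends b)\<^sup>*\<^sup>* (Node x (us @ t # ts)) (Node x (us @ t' # ts))"
    using Cons.hyps(1) by (rule extends_child_rtranclp)
  also have "(extends b)\<^sup>*\<^sup>* (Node x (us @ t' # ts)) (Node x (us @ t' # ts'))"
    using Cons.IH[of "us @ [t']"] by simp
  finally show ?case .
qed

text \<open>Work below one child leaves the branches through the others unchanged. For
  \<open>ts = []\<close> the second assumption would be vacuous, while the branch ending in
  \<open>x\<close> would still have to be closed.\<close>

lemma closable_Node:
  assumes "ts \<noteq> []" and "\<And>t. t \<in> set ts \<Longrightarrow> closable (b @ [x]) t"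
  shows "closable b (Node x ts)"
proof -
  obtain f where f: "\<And>t. t \<in> set ts \<Longrightarrow>
      (extends (b @ [x]))\<^sup>*\<^sup>* t (f t) \<and> (\<forall>c \<in> branches (f t). closed_branch ((b @ [x]) @ c))"
    using assms(2) unfolding closable_def by metis
  have "list_all2 (extends (b @ [x]))\<^sup>*\<^sup>* ts (map f ts)"
    using f by (simp add: list_all2_map2 list.rel_refl_strong)
  then have "(extends b)\<^sup>*\<^sup>* (Node x ts) (Node x (map f ts))"
    using extends_children_rtranclp[where us = "[]"] by (simp only: append_Nil)
  moreover have "\<forall>c \<in> branches (Node x (map f ts)). closed_branch (b @ c)"
    using assms(1) f by auto
  ultimately show ?thesis
    unfolding closable_def by blast
qed

text \<open>A chain has a single leaf, so closing the chain amounts to closing that leaf. The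
  assumption fixes only the set of formulas on the path, which makes the order of enumeration
  irrelevant.\<close>

lemma closable_sub_branch:
  assumes "sub_branch C t"
    and "\<And>c y. set (c @ [y]) = set b \<union> C \<Longrightarrow> closable c (Node y [])"
  shows "closable b t"
  using assms
proof (induction arbitrary: b rule: sub_branch.induct)
  case (single x)
  then show ?case by simp
next
  case (step x C t)
  have "closable (b @ [x]) t"
    by (rule step.IH, rule step.prems) simp
  then show ?case
    by (intro closable_Node) auto
qed

text \<open>Termination: the induction is on the number of formulas of the finite closure that are
  still missing from the branch.\<close>

lemma closable_leaf:
  assumes "\<And>H. hintikka H \<Longrightarrow> F \<alpha> \<notin> H"
    and "F \<alpha> \<in> set (b @ [x])" and "set (b @ [x]) \<subseteq> signed_closure \<alpha>"
  shows "closable b (Node x [])"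
  using assms(2,3)
proof (induction "card (signed_closure \<alpha> - set (b @ [x]))" arbitrary: b x rule: less_induct)
  case less
  show ?case
  proof (cases "closed_branch (b @ [x])")
    case True
    then show ?thesis
      unfolding closable_def by (intro exI[of _ "Node x []"]) simp
  next
    case False
    \<comment> \<open>As the branch has no clash, it must fail saturation: some applicable rule has
      none of its conclusion sets already on the branch.\<close>
    have "\<not> hintikka (set (b @ [x]))"
      using assms(1) less.prems(1) by blast
    with False obtain \<sigma> Cs where \<sigma>: "\<sigma> \<in> set (b @ [x])" "tableau_rule \<sigma> Cs"
        and new: "\<And>C. C \<in> set Cs \<Longrightarrow> \<not> C \<subseteq> set (b @ [x])"
      unfolding hintikka_def closed_branch_def by blast
    obtain ts where ts: "list_all2 sub_branch Cs ts"
      using tableau_rule_sub_branches[OF \<sigma>(2)] by blast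
    have "closable (b @ [x]) t" if t: "t \<in> set ts" for t
    proof -
      obtain C where C: "C \<in> set Cs" "sub_branch C t"
        using ts t by (metis in_set_conv_nth list_all2_conv_all_nth)
      have C_closure: "C \<subseteq> signed_closure \<alpha>"
        using tableau_rule_signed_closure[OF \<sigma>(2) _ C(1)] \<sigma>(1) less.prems(2) by blast
      show ?thesis
      proof (rule closable_sub_branch[OF C(2)])
        fix c y
        assume c: "set (c @ [y]) = set (b @ [x]) \<union> C"
        \<comment> \<open>The inclusion is strict because \<open>C\<close> contributes a closure
          formula that is not yet on the branch.\<close>
        have "signed_closure \<alpha> - set (c @ [y]) \<subset> signed_closure \<alpha> - set (b @ [x])"
          using new[OF C(1)] C_closure unfolding c by blast
        then have "card (signed_closure \<alpha> - set (c @ [y])) < card (signed_closure \<alpha> - set (b @ [x]))"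
          by (simp add: psubset_card_mono finite_signed_closure del: set_append)
        then show "closable c (Node y [])"
          by (rule less.hyps) (use c C_closure less.prems in blast)+
      qed
    qed
    moreover have "ts \<noteq> []"
      using ts tableau_rule_not_Nil[OF \<sigma>(2)] by auto
    ultimately have "closable b (Node x ts)"
      by (rule closable_Node[rotated])
    moreover have "extends b (Node x []) (Node x ts)"
      using False \<sigma> ts by (rule extends.leaf)
    ultimately show ?thesis
      unfolding closable_def by (meson converse_rtranclp_into_rtranclp)
  qed
qed

lemma tableau_extends_rtranclp:
  assumes "(extends [])\<^sup>*\<^sup>* t t'" "tableau \<eta> t"
  shows "tableau \<eta> t'"
  using assms by (induction rule: rtranclp_induct) (auto intro: tableau.extend)

theorem theorem5p8:
  fixes \<alpha> :: "'v fm"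
  assumes "\<Turnstile>\<^sub>T\<^sub>M\<^sub>L \<alpha>"
  shows "\<turnstile>\<^sub>T \<alpha>"
proof -
  have "closable [] (Node (F \<alpha>) [])"
    using valid_not_in_hintikka[OF assms]
    by (rule closable_leaf) (auto simp: signed_closure_def Let_def subformulas_refl)
  then obtain t where "(extends [])\<^sup>*\<^sup>* (Node (F \<alpha>) []) t" "\<forall>c \<in> branches t. closed_branch c"
    unfolding closable_def by auto
  then show ?thesis
    unfolding tableau_provable_def closed_tableau_def
    using tableau_extends_rtranclp tableau.root by blast
qed

end
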